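(* Let $k\ge 1$ and $\ell\ge 0$ be integers. Let $\mathbf{x}=(x_1,x_2,\ldots)$ and $\mathbf{y}=(y_1,y_2,\ldots)$ be complex valued sequences such that $\frac{x_i}{y_i}$ is a positive real number for all $1\le i\le k$ (in particular $x_i\ne0$ and $y_i\neq 0$), and such that $x_iy_j-y_ix_j\neq 0$ for all $1\le i,j\le k$ with $i\neq j$. Let $\mathbf{r}=(r_1,r_2,\ldots)$ be a sequence of positive real numbers that is injective, i.e. $r_i\ne r_j$ for $i\neq j$. Then the complex $k\times k$ matrix $A=(A_{ij})_{1\le i,j\le k}$ with entries $$A_{ij}=(x_i+r_jy_i)^\ell$$ is regular if and only if $k\le \ell+1$.
   Context: A square complex matrix is called regular if it is invertible (nonzero determinant). The convention $z^0=1$ for all complex $z$ is used. *)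

theory Defs
  imports Complex_Main "Jordan_Normal_Form.Determinant"
begin

(* Sequences (x_1, x_2, ...) are functions on nat whose value at 0 is irrelevant. *)

definition power_sum_matrix ::
  "nat \<Rightarrow> nat \<Rightarrow> (nat \<Rightarrow> complex) \<Rightarrow> (nat \<Rightarrow> complex) \<Rightarrow> (nat \<Rightarrow> real) \<Rightarrow> complex mat"
where
  (* mat counts rows and columns from 0, hence the Suc; 0 ^ 0 = 1 *)
  "power_sum_matrix k l x y r =
     mat k k (\<lambda>(i, j). (x (Suc i) + complex_of_real (r (Suc j)) * y (Suc i)) ^ l)"

end

(*
  Dividing row i by y_i^l reduces the matrix to (t_i + r_j)^l with t_i = x_i / y_i distinct and
  positive.  For k <= l + 1 a kernel vector c would make the function
  f t = (SUM j. c_j * (t + r_j)^l) vanish at k positive points.  Dividing f by one of the powers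
  (t + r_m)^l and differentiating removes the m-th term and leaves, up to a nonvanishing factor, a
  combination of k - 1 powers with exponent l - 1; by Rolle's theorem and induction all c_j vanish.
  For k > l + 1 the binomial theorem factors the matrix through a space of dimension l + 1.
*)
theory Submission
  imports Defs
begin

text \<open>Rolle's theorem is applied between neighbouring points of \<open>T\<close>; the interval
  condition on \<open>S\<close> keeps \<open>f\<close> differentiable there. The clause
  \<open>z < Max T\<close> strengthens the induction: after the largest zero is removed, all
  critical points found so far lie below the next largest one, so the new critical point differs
  from them.\<close>

lemma Rolle_card:
  fixes f f' :: "real \<Rightarrow> real"
  assumes S: "\<And>a b. a \<in> S \<Longrightarrow> b \<in> S \<Longrightarrow> {a..b} \<subseteq> S"
    and f': "\<And>t. t \<in> S \<Longrightarrow> (f has_real_derivative f' t) (at t)"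
    and T: "T \<subseteq> S" "card T = Suc n" "\<And>t. t \<in> T \<Longrightarrow> f t = 0"
  shows "\<exists>Z \<subseteq> S. finite Z \<and> card Z = n \<and> (\<forall>z\<in>Z. f' z = 0 \<and> z < Max T)"
  using T
proof (induction n arbitrary: T)
  case 0
  then show ?case by (intro exI[of _ "{}"]) auto
next
  case (Suc n)
  define m where "m = Max T"
  define T' where "T' = T - {m}"
  have fin: "finite T" using Suc.prems(2) by (simp add: card_ge_0_finite)
  have m: "m \<in> T" unfolding m_def using fin Suc.prems(2) by (intro Max_in) auto
  have T': "card T' = Suc n" "T' \<subseteq> T" "finite T'"
    using m fin Suc.prems(2) unfolding T'_def by auto
  obtain Z where Z: "Z \<subseteq> S" "card Z = n" "finite Z" "\<And>z. z \<in> Z \<Longrightarrow> f' z = 0 \<and> z < Max T'"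
    using Suc.IH[of T'] T' Suc.prems by (metis subset_iff)
  define p where "p = Max T'"
  have p: "p \<in> T'" unfolding p_def using T' by (intro Max_in) auto
  have "p \<noteq> m" "p \<in> T" using p unfolding T'_def by auto
  moreover have "p \<le> m" unfolding m_def using \<open>p \<in> T\<close> fin by simp
  ultimately have "p < m" by simp
  have sub: "{p..m} \<subseteq> S" using S m \<open>p \<in> T\<close> Suc.prems(1) by blast
  have "\<exists>z. p < z \<and> z < m \<and> f' z = 0"
  proof -
    have "\<exists>z. p < z \<and> z < m \<and> f m - f p = (m - p) * f' z"
      using f' sub \<open>p < m\<close> by (intro MVT2) auto
    moreover have "f m = 0" "f p = 0" using Suc.prems(3) m \<open>p \<in> T\<close> by auto
    ultimately show ?thesis using \<open>p < m\<close> by auto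
  qed
  then obtain z where z: "p < z" "z < m" "f' z = 0" by blast
  have "z \<in> S" using z sub by auto
  have "z \<notin> Z" using Z(4) z(1) unfolding p_def by force
  then have "card (insert z Z) = Suc n" using Z(2,3) by simp
  moreover have "\<forall>w\<in>insert z Z. f' w = 0 \<and> w < Max T"
    using Z(4) z \<open>p < m\<close> unfolding p_def m_def by force
  ultimately show ?case using Z(1,3) \<open>z \<in> S\<close> by (intro exI[of _ "insert z Z"]) auto
qed

text \<open>Stated over the reals, where Rolle's theorem applies. \<open>l\<close>, \<open>c\<close>
  and \<open>T\<close> vary in the induction: each step lowers the exponent, rescales the
  coefficients and replaces the zeros by critical points.\<close>

lemma shifted_powers_independent:
  fixes c r :: "'a \<Rightarrow> real"
  assumes "finite J" "inj_on r J" "\<And>j. j \<in> J \<Longrightarrow> r j > 0"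
    and "card J \<le> Suc l" "T \<subseteq> {0<..}" "card T = card J"
    and "\<And>t. t \<in> T \<Longrightarrow> (\<Sum>j\<in>J. c j * (t + r j) ^ l) = 0"
    and "i \<in> J"
  shows "c i = 0"
  using assms
proof (induction J arbitrary: l c T i rule: finite_induct)
  case empty
  then show ?case by simp
next
  case (insert m J)
  have pos: "t + r j > 0" if "t > 0" "j \<in> insert m J" for t j
    using that insert.prems(2) by (simp add: add_pos_pos)
  have cJ: "c j = 0" if "j \<in> J" for j
  proof -
    \<comment> \<open>With \<open>j\<close> in \<open>J\<close>, the set \<open>insert m J\<close>
      has at least two elements, so the bound \<open>Suc l\<close> on its size forces
      \<open>l > 0\<close> and the exponent can drop.\<close>
    have "card J > 0" using that insert.hyps(1) by (auto simp: card_gt_0_iff)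
    then obtain q where l: "l = Suc q"
      using insert.hyps insert.prems(3) by (cases l) auto
    define g where "g t = (\<Sum>j\<in>insert m J. c j * ((t + r j) / (t + r m)) ^ l)" for t
    \<comment> \<open>The quotient \<open>(t + r j) / (t + r m)\<close> has derivative
      \<open>(r m - r j) / (t + r m) ^ 2\<close>, which vanishes for \<open>j = m\<close>; hence the
      sum over \<open>J\<close> only. The denominators \<open>(t + r m) ^ q\<close> and
      \<open>(t + r m) ^ 2\<close> combine to the exponent \<open>q + 2 = Suc l\<close>.\<close>
    define g' where "g' t = real l / (t + r m) ^ Suc l *
      (\<Sum>j\<in>J. c j * (r m - r j) * (t + r j) ^ q)" for t
    have der: "(g has_real_derivative g' t) (at t)" if "t \<in> {0<..}" for t
    proof -
      have nz: "t + r m \<noteq> 0" using pos[of t m] that by simp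
      have quot: "((\<lambda>t. (t + r j) / (t + r m)) has_real_derivative
          (r m - r j) / (t + r m) ^ 2) (at t)" for j
        using nz by (auto intro!: derivative_eq_intros simp: power2_eq_square)
      have "(g has_real_derivative (\<Sum>j\<in>insert m J. c j * (real l *
          ((t + r j) / (t + r m)) ^ q * ((r m - r j) / (t + r m) ^ 2)))) (at t)"
        unfolding g_def
        by (intro DERIV_sum DERIV_cmult DERIV_cong[OF DERIV_power[OF quot]])
          (simp add: l)
      also have "(\<Sum>j\<in>insert m J. c j * (real l *
          ((t + r j) / (t + r m)) ^ q * ((r m - r j) / (t + r m) ^ 2))) = g' t"
        using insert.hyps nz unfolding g'_def l
        by (simp add: sum_distrib_left sum_divide_distrib power_divide power2_eq_square mult_ac)
      finally show ?thesis .
    qed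
    have zero: "g t = 0" if "t \<in> T" for t
    proof -
      have "g t = (\<Sum>j\<in>insert m J. c j * (t + r j) ^ l) / (t + r m) ^ l"
        unfolding g_def by (simp add: sum_divide_distrib power_divide)
      then show ?thesis using insert.prems(6) that by simp
    qed
    have cardT: "card T = Suc (card J)" using insert by simp
    have "\<exists>Z \<subseteq> {0<..}. finite Z \<and> card Z = card J \<and> (\<forall>z\<in>Z. g' z = 0 \<and> z < Max T)"
      by (rule Rolle_card[of "{0<..}" g g' T, OF _ der insert.prems(4) cardT zero]) auto
    then obtain Z where Z: "Z \<subseteq> {0<..}" "card Z = card J" "\<And>z. z \<in> Z \<Longrightarrow> g' z = 0"
      by blast
    have "(\<Sum>j\<in>J. c j * (r m - r j) * (z + r j) ^ q) = 0" if "z \<in> Z" for z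
    proof -
      have "z + r m \<noteq> 0" using pos[of z m] that Z(1) by force
      then show ?thesis using Z(3)[OF that] unfolding g'_def l by simp
    qed
    then have "c j * (r m - r j) = 0"
      using insert.prems insert.hyps Z(1,2) that l
      by (intro insert.IH[of q Z "\<lambda>j. c j * (r m - r j)" j]) auto
    moreover have "r m \<noteq> r j" using insert.prems(1) insert.hyps that by auto
    ultimately show ?thesis by simp
  qed
  \<comment> \<open>Only the term of \<open>m\<close> is left, so a single point of \<open>T\<close>
    suffices.\<close>
  obtain t where t: "t \<in> T" using insert.prems(5) insert.hyps by fastforce
  have "c m * (t + r m) ^ l = 0"
    using insert.prems(6)[OF t] insert.hyps cJ by simp
  moreover have "t + r m > 0" using pos[of t m] t insert.prems(4) by auto
  ultimately have "c m = 0" by simp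
  then show ?case using cJ insert.prems(7) by auto
qed

text \<open>The powers are real, so the real and imaginary parts of the coefficients satisfy the
  same equations separately.\<close>

lemma shifted_powers_independent_complex:
  fixes c :: "'a \<Rightarrow> complex" and r :: "'a \<Rightarrow> real"
  assumes "finite J" "inj_on r J" "\<And>j. j \<in> J \<Longrightarrow> r j > 0"
    and "card J \<le> Suc l" "T \<subseteq> {0<..}" "card T = card J"
    and zero: "\<And>t. t \<in> T \<Longrightarrow> (\<Sum>j\<in>J. c j * of_real ((t + r j) ^ l)) = 0"
    and "i \<in> J"
  shows "c i = 0"
proof -
  have "(\<Sum>j\<in>J. Re (c j) * (t + r j) ^ l) = 0" "(\<Sum>j\<in>J. Im (c j) * (t + r j) ^ l) = 0"
    if "t \<in> T" for t
    using arg_cong[OF zero[OF that], of Re] arg_cong[OF zero[OF that], of Im]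
    by (simp_all del: of_real_power of_real_add)
  then have "Re (c i) = 0" "Im (c i) = 0"
    using shifted_powers_independent[of J r l T "\<lambda>j. Re (c j)" i]
      shifted_powers_independent[of J r l T "\<lambda>j. Im (c j)" i] assms by blast+
  then show ?thesis by (simp add: complex_eq_iff)
qed

lemma invertible_mat_iff_det_nonzero:
  fixes A :: "'a :: field mat"
  assumes A: "A \<in> carrier_mat n n"
  shows "invertible_mat A \<longleftrightarrow> det A \<noteq> 0"
proof
  assume "invertible_mat A"
  then obtain B where B: "A * B = 1\<^sub>m n" "B * A = 1\<^sub>m (dim_row B)"
    using A unfolding invertible_mat_def inverts_mat_def by auto
  \<comment> \<open>Comparing column counts in \<open>A * B\<close> and \<open>B * A\<close> with
    those of the identity matrices gives both dimensions of \<open>B\<close>.\<close>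
  then have "B \<in> carrier_mat n n"
    using A by (metis carrier_mat_triv carrier_matD(2) index_mult_mat(3) index_one_mat(3))
  then have "det A * det B = 1" using B(1) det_mult[OF A] by (metis det_one)
  then show "det A \<noteq> 0" by auto
next
  assume "det A \<noteq> 0"
  from det_non_zero_imp_unit[OF A this, of "()"] show "invertible_mat A"
    using A unfolding Units_def ring_mat_def invertible_mat_def inverts_mat_def by auto
qed

lemma det_power_sum_matrix_eq_0:
  assumes "l + 1 < k"
  shows "det (power_sum_matrix k l x y r) = 0"
proof -
  \<comment> \<open>The binomial factorization has inner dimension \<open>l + 1\<close>. Padding
    \<open>B\<close> with zero columns makes both factors square, so that determinants
    multiply.\<close>
  define B where "B = mat k k (\<lambda>(i, m).
    if m \<le> l then of_nat (l choose m) * x (Suc i) ^ (l - m) * y (Suc i) ^ m else 0)"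
  define C where "C = mat k k (\<lambda>(m, j). complex_of_real (r (Suc j)) ^ m)"
  have BC: "B \<in> carrier_mat k k" "C \<in> carrier_mat k k" unfolding B_def C_def by auto
  have "power_sum_matrix k l x y r = B * C"
  proof (rule eq_matI)
    fix i j assume "i < dim_row (B * C)" "j < dim_col (B * C)"
    then have ij: "i < k" "j < k" using BC by auto
    have "(B * C) $$ (i, j) = (\<Sum>m\<in>{0..<k}. B $$ (i, m) * C $$ (m, j))"
      using ij BC by (simp add: scalar_prod_def)
    also have "\<dots> = (\<Sum>m\<le>l. B $$ (i, m) * C $$ (m, j))"
      using assms ij unfolding B_def by (intro sum.mono_neutral_right) auto
    also have "\<dots> = (\<Sum>m\<le>l. of_nat (l choose m) *
        (of_real (r (Suc j)) * y (Suc i)) ^ m * x (Suc i) ^ (l - m))"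
      using assms ij unfolding B_def C_def by (intro sum.cong) (auto simp: power_mult_distrib)
    also have "\<dots> = (x (Suc i) + of_real (r (Suc j)) * y (Suc i)) ^ l"
      by (subst add.commute) (simp add: binomial_ring)
    finally show "power_sum_matrix k l x y r $$ (i, j) = (B * C) $$ (i, j)"
      using ij by (simp add: power_sum_matrix_def)
  qed (use BC in \<open>auto simp: power_sum_matrix_def\<close>)
  moreover have "det B = 0"
  proof -
    \<comment> \<open>The last column of \<open>B\<close> is zero, since \<open>l + 1 < k\<close>
      gives \<open>k - 1 > l\<close>.\<close>
    have "B *\<^sub>v unit_vec k (k - 1) = 0\<^sub>v k"
      using assms unfolding B_def by (intro eq_vecI) auto
    moreover have "unit_vec k (k - 1) \<noteq> (0\<^sub>v k :: complex vec)" using assms by simp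
    ultimately show ?thesis
      using det_0_iff_vec_prod_zero_field[OF BC(1)] unit_vec_carrier by blast
  qed
  ultimately show ?thesis using det_mult[OF BC] by simp
qed

lemma det_power_sum_matrix_nonzero:
  fixes t r :: "nat \<Rightarrow> real"
  assumes "k \<le> l + 1"
    and x: "\<And>i. i \<in> {1..k} \<Longrightarrow> x i = of_real (t i) * y i"
    and y: "\<And>i. i \<in> {1..k} \<Longrightarrow> y i \<noteq> 0"
    and t: "\<And>i. i \<in> {1..k} \<Longrightarrow> t i > 0" "inj_on t {1..k}"
    and r: "\<And>i. i \<in> {1..k} \<Longrightarrow> r i > 0" "inj_on r {1..k}"
  shows "det (power_sum_matrix k l x y r) \<noteq> 0"
proof
  let ?A = "power_sum_matrix k l x y r"
  have A: "?A \<in> carrier_mat k k" by (simp add: power_sum_matrix_def)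
  assume "det ?A = 0"
  then obtain v where v: "v \<in> carrier_vec k" "v \<noteq> 0\<^sub>v k" "?A *\<^sub>v v = 0\<^sub>v k"
    using det_0_iff_vec_prod_zero_field[OF A] by blast
  \<comment> \<open>Row \<open>i\<close> of \<open>?A\<close> applied to \<open>v\<close> is this
    sum at \<open>s = t (Suc i)\<close>, multiplied by the nonzero factor
    \<open>y (Suc i) ^ l\<close>.\<close>
  have zero: "(\<Sum>j<k. v $ j * of_real ((s + r (Suc j)) ^ l)) = 0" if "s \<in> t ` {1..k}" for s
  proof -
    from that have "s \<in> t ` Suc ` {..<k}" by (simp add: image_Suc_lessThan)
    then obtain i where i: "i < k" "s = t (Suc i)" by blast
    have "0 = (?A *\<^sub>v v) $ i" using v(3) i by simp
    also have "\<dots> = (\<Sum>j<k. (x (Suc i) + of_real (r (Suc j)) * y (Suc i)) ^ l * v $ j)"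
      using i v(1) A by (simp add: power_sum_matrix_def scalar_prod_def lessThan_atLeast0)
    also have "\<dots> = (\<Sum>j<k. y (Suc i) ^ l * (v $ j * of_real ((s + r (Suc j)) ^ l)))"
      using i x[of "Suc i"]
      by (intro sum.cong) (auto simp flip: power_mult_distrib simp: algebra_simps)
    finally show ?thesis using y[of "Suc i"] i by (simp flip: sum_distrib_left)
  qed
  have "inj_on (\<lambda>j. r (Suc j)) {..<k}"
    using r(2) comp_inj_on[of Suc "{..<k}" r] by (simp add: image_Suc_lessThan comp_def)
  moreover have "r (Suc j) > 0" if "j \<in> {..<k}" for j using r(1) that by simp
  moreover have "card {..<k} \<le> Suc l" "t ` {1..k} \<subseteq> {0<..}" using assms(1) t(1) by auto
  moreover have "card (t ` {1..k}) = card {..<k}" using card_image[OF t(2)] by simp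
  ultimately have "v $ i = 0" if "i < k" for i
    using shifted_powers_independent_complex[of "{..<k}" "\<lambda>j. r (Suc j)" l "t ` {1..k}"
        "\<lambda>j. v $ j" i] zero that by blast
  then have "v = 0\<^sub>v k" using v(1) by (intro eq_vecI) auto
  with v(2) show False by simp
qed

theorem theorem7:
  fixes k l :: nat
    and x y :: "nat \<Rightarrow> complex"
    and r :: "nat \<Rightarrow> real"
  assumes "k \<ge> 1"
    and "\<forall>i\<in>{1..k}. x i \<noteq> 0 \<and> y i \<noteq> 0 \<and> (\<exists>c::real. c > 0 \<and> x i / y i = complex_of_real c)"
    and "\<forall>i\<in>{1..k}. \<forall>j\<in>{1..k}. i \<noteq> j \<longrightarrow> x i * y j - y i * x j \<noteq> 0"
    and "\<forall>i\<ge>1. r i > 0"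
    and "inj_on r {1..}"
  shows "invertible_mat (power_sum_matrix k l x y r) \<longleftrightarrow> k \<le> l + 1"
proof -
  have A: "power_sum_matrix k l x y r \<in> carrier_mat k k" by (simp add: power_sum_matrix_def)
  obtain t where t: "\<And>i. i \<in> {1..k} \<Longrightarrow> t i > 0 \<and> x i / y i = complex_of_real (t i)"
    using assms(2) by metis
  then have x: "x i = of_real (t i) * y i" if "i \<in> {1..k}" for i
    using assms(2) that by (metis nonzero_eq_divide_eq)
  have "inj_on t {1..k}"
  proof (rule inj_onI, rule ccontr)
    fix i j assume ij: "i \<in> {1..k}" "j \<in> {1..k}" "t i = t j" "i \<noteq> j"
    \<comment> \<open>Equal ratios make the pairs \<open>(x i, y i)\<close> and
      \<open>(x j, y j)\<close> proportional, so their 2 by 2 determinant vanishes.\<close>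
    have "x i * y j - y i * x j = 0" using x[OF ij(1)] x[OF ij(2)] ij(3) by simp
    then show False using assms(3) ij by blast
  qed
  moreover have "inj_on r {1..k}" using assms(5) by (rule inj_on_subset) auto
  ultimately have "det (power_sum_matrix k l x y r) \<noteq> 0" if "k \<le> l + 1"
    using det_power_sum_matrix_nonzero[OF that x] t assms(2,4) by auto
  then show ?thesis
    using invertible_mat_iff_det_nonzero[OF A] det_power_sum_matrix_eq_0[of l k x y r] by force
qed

end
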